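(* Let $(T,\Delta_{-1},\Delta_0,\Delta_1,\alpha)$ be a Hom-tridendriform coalgebra. Put $\gamma=(1-\tau)\circ\Delta_0$ and $\Delta_\ast=\Delta_1-\tau\circ\Delta_{-1}$. Then $(T,\gamma,\Delta_\ast,\alpha)$ is a post-Hom-Lie coalgebra, with Hom-Lie cobracket $\gamma$ and comultiplication $\Delta_\ast$.
   Context: All vector spaces are over a field $\mathbb{F}$ of characteristic $0$; $I$ is the identity map, $\tau(x\otimes y)=y\otimes x$, $\xi(x\otimes y\otimes z)=y\otimes z\otimes x$, $\xi^2(x\otimes y\otimes z)=z\otimes x\otimes y$. A Hom-tridendriform coalgebra $(C,\Delta_{-1},\Delta_0,\Delta_1,\alpha)$ is a vector space $C$ with linear maps $\Delta_{-1},\Delta_0,\Delta_1:C\to C\otimes C$ and a linear map $\alpha:C\to C$ such that (1) $(\Delta_{-1}\otimes\alpha)\circ\Delta_{-1}=(\alpha\otimes\Delta_{-1}+\alpha\otimes\Delta_1+\alpha\otimes\Delta_0)\circ\Delta_{-1}$; (2) $(\Delta_1\otimes\alpha)\circ\Delta_{-1}=(\alpha\otimes\Delta_{-1})\circ\Delta_1$; (3) $(\alpha\otimes\Delta_1)\circ\Delta_1=(\Delta_{-1}\otimes\alpha+\Delta_1\otimes\alpha+\Delta_0\otimes\alpha)\circ\Delta_1$; (4) $(\Delta_{-1}\otimes\alpha)\circ\Delta_0=(\alpha\otimes\Delta_1)\circ\Delta_0$; (5) $(\Delta_1\otimes\alpha)\circ\Delta_0=(\alpha\otimes\Delta_0)\circ\Delta_1$;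 (6) $(\Delta_0\otimes\alpha)\circ\Delta_{-1}=(\alpha\otimes\Delta_{-1})\circ\Delta_0$; (7) $(\Delta_0\otimes\alpha)\circ\Delta_0=(\alpha\otimes\Delta_0)\circ\Delta_0$. A post-Hom-Lie coalgebra (with cobracket $\gamma$ and comultiplication $\Delta$) is a vector space $C$ with linear maps $\Delta,\gamma:C\to C\otimes C$ and $\alpha:C\to C$ such that (i) $\gamma=-\tau\circ\gamma$ and $\gamma\circ\alpha=(\alpha\otimes\alpha)\circ\gamma$; (ii) $(1+\xi+\xi^2)\circ(\alpha\otimes\gamma)\circ\gamma=0$; (iii) $(\alpha\otimes\gamma)\circ\Delta-(\Delta\otimes\alpha)\circ\gamma-(\tau\otimes I)\circ(\alpha\otimes\Delta)\circ\gamma=0$; (iv) $(\Delta\otimes\alpha)\circ\Delta-(\alpha\otimes\Delta)\circ\Delta-(\tau\otimes I)\circ(\Delta\otimes\alpha)\circ\Delta+(\tau\otimes I)\circ(\alpha\otimes\Delta)\circ\Delta+(\gamma\otimes\alpha)\circ\Delta=0$.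
   Formalization: γ∘α=(α⊗α)∘γ is claimed only when Δ_0∘α=(α⊗α)∘Δ_0; all other post-Hom-Lie conditions hold unconditionally. Without this the claim is false: basis a,b, Δ_0(x)=a⊗x, Δ_{-1}=Δ_1=0, α=2·id. *)

theory Defs
  imports Complex_Main "HOL-Library.Function_Algebras"
begin

section \<open>Tensor products of vector spaces\<close>

text \<open>
  Sums and differences of maps are pointwise, through \<^theory>\<open>HOL-Library.Function_Algebras\<close>.
  Beware that \<open>\<circ>\<close> binds weaker than \<open>+\<close> and \<open>-\<close>.
  \<open>Vector_Spaces.linear s1 s2 f\<close> is written in full because \<open>linear\<close> alone means real-linear.
\<close>

definition bilinear_map ::
  "('f::field \<Rightarrow> 'v::ab_group_add \<Rightarrow> 'v) \<Rightarrow> ('f \<Rightarrow> 'w::ab_group_add \<Rightarrow> 'w) \<Rightarrow>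
   ('f \<Rightarrow> 'x::ab_group_add \<Rightarrow> 'x) \<Rightarrow> ('v \<Rightarrow> 'w \<Rightarrow> 'x) \<Rightarrow> bool" where
  "bilinear_map sV sW sX \<beta> \<longleftrightarrow>
     (\<forall>y. Vector_Spaces.linear sV sX (\<lambda>x. \<beta> x y)) \<and> (\<forall>x. Vector_Spaces.linear sW sX (\<beta> x))"

text \<open>
  A tensor product \<open>V \<otimes> W\<close> is a vector space \<open>T\<close> with a bilinear map \<open>tens : V \<times> W \<rightarrow> T\<close> having the
  universal property. A locale cannot quantify over all target types, so the property is assumed
  for the target \<open>F\<close> only; over a field this already gives it for every target vector space, which
  is lemma \<open>universal_property\<close> below.
\<close>

locale tensor_product =
  V: vector_space sV + W: vector_space sW + T: vector_space sT
  for sV :: "'f::field \<Rightarrow> 'v::ab_group_add \<Rightarrow> 'v"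
    and sW :: "'f \<Rightarrow> 'w::ab_group_add \<Rightarrow> 'w"
    and sT :: "'f \<Rightarrow> 't::ab_group_add \<Rightarrow> 't" +
  fixes tens :: "'v \<Rightarrow> 'w \<Rightarrow> 't"
  assumes bilinear_tens: "bilinear_map sV sW sT tens"
    and universal: "\<And>\<beta>. bilinear_map sV sW ((*) :: 'f \<Rightarrow> 'f \<Rightarrow> 'f) \<beta> \<Longrightarrow>
      \<exists>!\<phi>. Vector_Spaces.linear sT (*) \<phi> \<and> (\<forall>x y. \<phi> (tens x y) = \<beta> x y)"
begin

definition lift :: "('f \<Rightarrow> 'x::ab_group_add \<Rightarrow> 'x) \<Rightarrow> ('v \<Rightarrow> 'w \<Rightarrow> 'x) \<Rightarrow> 't \<Rightarrow> 'x" where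
  "lift sX \<beta> = (THE \<phi>. Vector_Spaces.linear sT sX \<phi> \<and> (\<forall>x y. \<phi> (tens x y) = \<beta> x y))"

end

lemma vector_space_self: "vector_space ((*) :: 'f::field \<Rightarrow> 'f \<Rightarrow> 'f)"
  by unfold_locales (auto simp: algebra_simps)

lemma linear_comp:
  assumes "Vector_Spaces.linear s1 s2 f" "Vector_Spaces.linear s2 s3 g"
  shows "Vector_Spaces.linear s1 s3 (\<lambda>x. g (f x))"
  using Vector_Spaces.linear_compose[OF assms] by (simp add: o_def)

lemma bilinear_map_comp:
  assumes "bilinear_map sV sW sX \<beta>" "Vector_Spaces.linear sX sY f"
  shows "bilinear_map sV sW sY (\<lambda>x y. f (\<beta> x y))"
  unfolding bilinear_map_def
proof (intro conjI allI)
  show "Vector_Spaces.linear sV sY (\<lambda>x. f (\<beta> x y))" for y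
    by (rule linear_comp[OF _ assms(2)]) (use assms(1) in \<open>simp add: bilinear_map_def\<close>)
  show "Vector_Spaces.linear sW sY (\<lambda>y. f (\<beta> x y))" for x
    by (rule linear_comp[OF _ assms(2)]) (use assms(1) in \<open>simp add: bilinear_map_def\<close>)
qed

lemma (in vector_space) functional_separates:
  assumes S: "subspace S" and v: "v \<notin> S"
  obtains f where "Vector_Spaces.linear scale (*) f" "f v = 1" "\<And>x. x \<in> S \<Longrightarrow> f x = 0"
proof -
  interpret P: vector_space_pair scale "(*)"
    by (intro vector_space_pair.intro vector_space_axioms vector_space_self)
  obtain B where B: "B \<subseteq> S" "independent B" "S \<subseteq> span B"
    using maximal_independent_subset .
  have SB: "span B = S" using B S span_minimal by blast
  have "independent (insert v B)" using v SB B(2) by (simp add: independent_insertI)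
  from P.linear_independent_extend[OF this, of "\<lambda>x. if x = v then 1 else 0"]
  obtain f where f: "Vector_Spaces.linear scale (*) f"
    "\<forall>x\<in>insert v B. f x = (if x = v then 1 else 0)" by blast
  have vB: "v \<notin> B" using v B(1) by blast
  have "f x = 0" if "x \<in> S" for x
  proof (rule P.linear_eq_on[OF f(1) P.module_hom_zero, of x B])
    show "x \<in> span B" using that SB by simp
    show "f b = 0" if "b \<in> B" for b using f(2) vB that by (metis insertCI)
  qed
  then show thesis using f by (intro that[of f]) auto
qed

context tensor_product
begin

lemma span_tens: "T.span (range (\<lambda>(x, y). tens x y)) = UNIV"
proof (rule ccontr)
  let ?S = "T.span (range (\<lambda>(x, y). tens x y))"
  assume "?S \<noteq> UNIV"
  then obtain v where "v \<notin> ?S" by blast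
  then obtain f where f: "Vector_Spaces.linear sT (*) f" "f v = 1" "\<And>x. x \<in> ?S \<Longrightarrow> f x = 0"
    by (rule T.functional_separates[OF T.subspace_span]) blast
  interpret P: vector_space_pair sT "(*)"
    by (intro vector_space_pair.intro T.vector_space_axioms vector_space_self)
  have z: "Vector_Spaces.linear sT (*) (\<lambda>x. 0 :: 'f)" by (rule P.module_hom_zero)
  have f0: "f (tens x y) = 0" for x y by (rule f(3), rule T.span_base) auto
  have "bilinear_map sV sW (*) (\<lambda>x y. 0 :: 'f)"
    using bilinear_map_comp[OF bilinear_tens z] .
  from universal[OF this] have "f = (\<lambda>x. 0)" by (rule ex1E) (metis f(1) f0 z)
  then show False using f(2) by simp
qed

lemma linear_eqI:
  assumes "Vector_Spaces.linear sT sX \<phi>" "Vector_Spaces.linear sT sX \<psi>"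
    and eq: "\<And>x y. \<phi> (tens x y) = \<psi> (tens x y)"
  shows "\<phi> = \<psi>"
proof
  fix v
  interpret L: Vector_Spaces.linear sT sX \<phi> by fact
  interpret P: vector_space_pair sT sX by unfold_locales
  show "\<phi> v = \<psi> v"
    by (rule P.linear_eq_on[OF assms(1,2), of v "range (\<lambda>(x, y). tens x y)"])
       (auto simp: span_tens eq)
qed

theorem universal_property:
  assumes X: "vector_space sX" and \<beta>: "bilinear_map sV sW sX \<beta>"
  shows "\<exists>!\<phi>. Vector_Spaces.linear sT sX \<phi> \<and> (\<forall>x y. \<phi> (tens x y) = \<beta> x y)"
proof (rule ex_ex1I)
  interpret X: vector_space sX by fact
  interpret P: vector_space_pair sT sX by unfold_locales
  interpret Q: vector_space_pair sT "(*)"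
    by (intro vector_space_pair.intro T.vector_space_axioms vector_space_self)
  obtain B where B: "B \<subseteq> range (\<lambda>(x, y). tens x y)" "T.independent B"
    "range (\<lambda>(x, y). tens x y) \<subseteq> T.span B"
    using T.maximal_independent_subset .
  have UB: "T.span B = UNIV"
    using T.span_minimal[OF B(3) T.subspace_span] span_tens by auto
  have "\<exists>p. b = tens (fst p) (snd p)" if "b \<in> B" for b using B(1) that by fastforce
  then have "\<forall>b\<in>B. \<exists>p. b = tens (fst p) (snd p)" by blast
  from bchoice[OF this] obtain p where
    p: "\<And>b. b \<in> B \<Longrightarrow> b = tens (fst (p b)) (snd (p b))" by blast
  from P.linear_independent_extend[OF B(2), of "\<lambda>b. \<beta> (fst (p b)) (snd (p b))"]
  obtain \<phi> where \<phi>: "Vector_Spaces.linear sT sX \<phi>"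
    "\<forall>b\<in>B. \<phi> b = \<beta> (fst (p b)) (snd (p b))" by blast
  have "\<phi> (tens x y) = \<beta> x y" for x y
  proof (rule ccontr)
    assume "\<phi> (tens x y) \<noteq> \<beta> x y"
    then have "\<phi> (tens x y) - \<beta> x y \<notin> {0}" by simp
    then obtain f where f: "Vector_Spaces.linear sX (*) f" "f (\<phi> (tens x y) - \<beta> x y) = 1"
      by (rule X.functional_separates[OF X.subspace_single_0]) blast
    from universal[OF bilinear_map_comp[OF \<beta> f(1)]]
    obtain \<psi> where \<psi>: "Vector_Spaces.linear sT (*) \<psi>" "\<And>x y. \<psi> (tens x y) = f (\<beta> x y)" by blast
    have "f (\<phi> (tens x y)) = \<psi> (tens x y)"
    proof (rule Q.linear_eq_on[OF linear_comp[OF \<phi>(1) f(1)] \<psi>(1), of _ B])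
      show "tens x y \<in> T.span B" by (simp add: UB)
      show "f (\<phi> b) = \<psi> b" if "b \<in> B" for b
        using \<phi>(2) that \<psi>(2)[of "fst (p b)" "snd (p b)", folded p[OF that]] by simp
    qed
    moreover interpret F: Vector_Spaces.linear sX "(*)" f by fact
    have "f (\<phi> (tens x y)) - f (\<beta> x y) = 1" using f(2) by (simp add: F.diff)
    ultimately show False by (simp add: \<psi>(2))
  qed
  then show "\<exists>\<phi>. Vector_Spaces.linear sT sX \<phi> \<and> (\<forall>x y. \<phi> (tens x y) = \<beta> x y)" using \<phi>(1) by blast
qed (rule linear_eqI, auto)

lemma
  assumes "vector_space sX" "bilinear_map sV sW sX \<beta>"
  shows linear_lift: "Vector_Spaces.linear sT sX (lift sX \<beta>)"
    and lift_tens: "lift sX \<beta> (tens x y) = \<beta> x y"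
  using theI'[OF universal_property[OF assms]] unfolding lift_def by simp_all

end

text \<open>
  \<open>C2\<close> is \<open>C \<otimes> C\<close>; \<open>C3\<close> is at the same time \<open>(C \<otimes> C) \<otimes> C\<close> (through \<open>tL\<close>) and \<open>C \<otimes> (C \<otimes> C)\<close>
  (through \<open>tR\<close>), \<open>assoc\<close> being the usual identification of the two.
\<close>

locale tensor_powers =
  C2: tensor_product s s s2 t + L: tensor_product s2 s s3 tL + R: tensor_product s s2 s3 tR
  for s :: "'f::field \<Rightarrow> 'c::ab_group_add \<Rightarrow> 'c"
    and s2 :: "'f \<Rightarrow> 'c2::ab_group_add \<Rightarrow> 'c2"
    and s3 :: "'f \<Rightarrow> 'c3::ab_group_add \<Rightarrow> 'c3"
    and t :: "'c \<Rightarrow> 'c \<Rightarrow> 'c2"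
    and tL :: "'c2 \<Rightarrow> 'c \<Rightarrow> 'c3"
    and tR :: "'c \<Rightarrow> 'c2 \<Rightarrow> 'c3" +
  assumes assoc: "tL (t x y) z = tR x (t y z)"
begin

definition map11 :: "('c \<Rightarrow> 'c) \<Rightarrow> ('c \<Rightarrow> 'c) \<Rightarrow> 'c2 \<Rightarrow> 'c2" (infixr \<open>\<otimes>\<^sub>1\<^sub>1\<close> 75) where
  "f \<otimes>\<^sub>1\<^sub>1 g = C2.lift s2 (\<lambda>x y. t (f x) (g y))"

definition map21 :: "('c \<Rightarrow> 'c2) \<Rightarrow> ('c \<Rightarrow> 'c) \<Rightarrow> 'c2 \<Rightarrow> 'c3" (infixr \<open>\<otimes>\<^sub>2\<^sub>1\<close> 75) where
  "f \<otimes>\<^sub>2\<^sub>1 g = C2.lift s3 (\<lambda>x y. tL (f x) (g y))"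

definition map12 :: "('c \<Rightarrow> 'c) \<Rightarrow> ('c \<Rightarrow> 'c2) \<Rightarrow> 'c2 \<Rightarrow> 'c3" (infixr \<open>\<otimes>\<^sub>1\<^sub>2\<close> 75) where
  "f \<otimes>\<^sub>1\<^sub>2 g = C2.lift s3 (\<lambda>x y. tR (f x) (g y))"

definition \<tau> :: "'c2 \<Rightarrow> 'c2" where
  "\<tau> = C2.lift s2 (\<lambda>x y. t y x)"

definition \<tau>I :: "'c3 \<Rightarrow> 'c3" where \<comment> \<open>\<open>\<tau> \<otimes> I\<close>\<close>
  "\<tau>I = L.lift s3 (\<lambda>p z. tL (\<tau> p) z)"

definition \<xi> :: "'c3 \<Rightarrow> 'c3" where
  "\<xi> = R.lift s3 (\<lambda>x p. tL p x)"

end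

section \<open>Coalgebras\<close>

locale hom_tridendriform_coalgebra =
  tensor_powers s s2 s3 t tL tR
  for s :: "'f::field \<Rightarrow> 'c::ab_group_add \<Rightarrow> 'c"
    and s2 :: "'f \<Rightarrow> 'c2::ab_group_add \<Rightarrow> 'c2"
    and s3 :: "'f \<Rightarrow> 'c3::ab_group_add \<Rightarrow> 'c3"
    and t tL tR +
  fixes Dm D0 D1 :: "'c \<Rightarrow> 'c2" and \<alpha> :: "'c \<Rightarrow> 'c"
  assumes linear_Dm: "Vector_Spaces.linear s s2 Dm"
    and linear_D0: "Vector_Spaces.linear s s2 D0"
    and linear_D1: "Vector_Spaces.linear s s2 D1"
    and linear_\<alpha>: "Vector_Spaces.linear s s \<alpha>"
    and tridend1: "(Dm \<otimes>\<^sub>2\<^sub>1 \<alpha>) \<circ> Dm = ((\<alpha> \<otimes>\<^sub>1\<^sub>2 Dm) + (\<alpha> \<otimes>\<^sub>1\<^sub>2 D1) + (\<alpha> \<otimes>\<^sub>1\<^sub>2 D0)) \<circ> Dm"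
    and tridend2: "(D1 \<otimes>\<^sub>2\<^sub>1 \<alpha>) \<circ> Dm = (\<alpha> \<otimes>\<^sub>1\<^sub>2 Dm) \<circ> D1"
    and tridend3: "(\<alpha> \<otimes>\<^sub>1\<^sub>2 D1) \<circ> D1 = ((Dm \<otimes>\<^sub>2\<^sub>1 \<alpha>) + (D1 \<otimes>\<^sub>2\<^sub>1 \<alpha>) + (D0 \<otimes>\<^sub>2\<^sub>1 \<alpha>)) \<circ> D1"
    and tridend4: "(Dm \<otimes>\<^sub>2\<^sub>1 \<alpha>) \<circ> D0 = (\<alpha> \<otimes>\<^sub>1\<^sub>2 D1) \<circ> D0"
    and tridend5: "(D1 \<otimes>\<^sub>2\<^sub>1 \<alpha>) \<circ> D0 = (\<alpha> \<otimes>\<^sub>1\<^sub>2 D0) \<circ> D1"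
    and tridend6: "(D0 \<otimes>\<^sub>2\<^sub>1 \<alpha>) \<circ> Dm = (\<alpha> \<otimes>\<^sub>1\<^sub>2 Dm) \<circ> D0"
    and tridend7: "(D0 \<otimes>\<^sub>2\<^sub>1 \<alpha>) \<circ> D0 = (\<alpha> \<otimes>\<^sub>1\<^sub>2 D0) \<circ> D0"

text \<open>
  The definition of a post-Hom-Lie coalgebra is split in two: the first locale has every condition
  except comultiplicativity of \<open>\<alpha>\<close> for the cobracket, which \<open>post_hom_lie_coalgebra\<close> adds. The
  axioms of a Hom-tridendriform coalgebra do not imply comultiplicativity: for a coassociative
  \<open>\<Delta>\<close> that is not cocommutative, take \<open>D0 = \<Delta>\<close>, \<open>Dm = D1 = 0\<close> and \<open>\<alpha> = 2 id\<close>.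
\<close>

locale post_hom_lie_coalgebra_nonmult =
  tensor_powers s s2 s3 t tL tR
  for s :: "'f::field \<Rightarrow> 'c::ab_group_add \<Rightarrow> 'c"
    and s2 :: "'f \<Rightarrow> 'c2::ab_group_add \<Rightarrow> 'c2"
    and s3 :: "'f \<Rightarrow> 'c3::ab_group_add \<Rightarrow> 'c3"
    and t tL tR +
  fixes \<gamma> D :: "'c \<Rightarrow> 'c2" and \<alpha> :: "'c \<Rightarrow> 'c"
  assumes linear_\<gamma>: "Vector_Spaces.linear s s2 \<gamma>"
    and linear_D: "Vector_Spaces.linear s s2 D"
    and linear_\<alpha>: "Vector_Spaces.linear s s \<alpha>"
    and skew: "\<gamma> = - (\<tau> \<circ> \<gamma>)"
    and hom_jacobi: "(id + \<xi> + (\<xi> \<circ> \<xi>)) \<circ> (\<alpha> \<otimes>\<^sub>1\<^sub>2 \<gamma>) \<circ> \<gamma> = 0"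
    and post_lie1: "((\<alpha> \<otimes>\<^sub>1\<^sub>2 \<gamma>) \<circ> D) - ((D \<otimes>\<^sub>2\<^sub>1 \<alpha>) \<circ> \<gamma>) - (\<tau>I \<circ> (\<alpha> \<otimes>\<^sub>1\<^sub>2 D) \<circ> \<gamma>) = 0"
    and post_lie2: "((D \<otimes>\<^sub>2\<^sub>1 \<alpha>) \<circ> D) - ((\<alpha> \<otimes>\<^sub>1\<^sub>2 D) \<circ> D) - (\<tau>I \<circ> (D \<otimes>\<^sub>2\<^sub>1 \<alpha>) \<circ> D)
      + (\<tau>I \<circ> (\<alpha> \<otimes>\<^sub>1\<^sub>2 D) \<circ> D) + ((\<gamma> \<otimes>\<^sub>2\<^sub>1 \<alpha>) \<circ> D) = 0"

locale post_hom_lie_coalgebra =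
  post_hom_lie_coalgebra_nonmult s s2 s3 t tL tR \<gamma> D \<alpha>
  for s :: "'f::field \<Rightarrow> 'c::ab_group_add \<Rightarrow> 'c"
    and s2 :: "'f \<Rightarrow> 'c2::ab_group_add \<Rightarrow> 'c2"
    and s3 :: "'f \<Rightarrow> 'c3::ab_group_add \<Rightarrow> 'c3"
    and t tL tR \<gamma> D \<alpha> +
  assumes comultiplicative: "\<gamma> \<circ> \<alpha> = (\<alpha> \<otimes>\<^sub>1\<^sub>1 \<alpha>) \<circ> \<gamma>"

end

theory Submission
  imports Defs
begin

text \<open>
  The symmetric group on three letters acts on \<open>C3\<close>, generated by \<open>\<tau>I\<close> and \<open>\<xi>\<close>. Since
  \<open>(f \<otimes> \<alpha>) \<circ> \<tau> = \<xi> \<circ> (\<alpha> \<otimes> f)\<close>, every composite in the post-Hom-Lie axioms is a sum of group elements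
  applied to \<open>(D\<^sub>i \<otimes> \<alpha>) \<circ> D\<^sub>j\<close> and \<open>(\<alpha> \<otimes> D\<^sub>i) \<circ> D\<^sub>j\<close>, and these sums cancel by the tridendriform
  axioms and the relations \<open>\<tau>I\<^sup>2 = \<xi>\<^sup>3 = 1\<close>, \<open>\<xi> \<tau>I = \<tau>I \<xi>\<^sup>2\<close>.
\<close>

section \<open>Linear and bilinear maps\<close>

lemma linear_diff_fun:
  assumes "Vector_Spaces.linear s1 s2 f" "Vector_Spaces.linear s1 s2 g"
  shows "Vector_Spaces.linear s1 s2 (f - g)"
proof -
  interpret F: Vector_Spaces.linear s1 s2 f by fact
  interpret P: vector_space_pair s1 s2 by unfold_locales
  show ?thesis using P.linear_compose_sub[OF assms] by (simp add: fun_diff_def)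
qed

lemma linear_comp_fun:
  assumes "Vector_Spaces.linear s2 s3 g" "Vector_Spaces.linear s1 s2 f"
  shows "Vector_Spaces.linear s1 s3 (g \<circ> f)"
  using Vector_Spaces.linear_compose[OF assms(2,1)] .

lemma linear_map_diff: "Vector_Spaces.linear s1 s2 f \<Longrightarrow> f (x - y) = f x - f y"
  by (metis Vector_Spaces.linear.axioms(3) module_hom.diff)

lemma linear_map_add: "Vector_Spaces.linear s1 s2 f \<Longrightarrow> f (x + y) = f x + f y"
  by (metis Vector_Spaces.linear.axioms(3) module_hom.add)

lemma linear_ident: "vector_space s \<Longrightarrow> Vector_Spaces.linear s s (\<lambda>x. x)"
  using vector_space.linear_id by (simp add: id_def)

lemma bilinear_map_pre:
  assumes "bilinear_map sV sW sX \<beta>"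
    and "Vector_Spaces.linear sA sV f" "Vector_Spaces.linear sB sW g"
  shows "bilinear_map sA sB sX (\<lambda>x y. \<beta> (f x) (g y))"
  unfolding bilinear_map_def
proof (intro conjI allI)
  show "Vector_Spaces.linear sA sX (\<lambda>x. \<beta> (f x) (g y))" for y
    by (rule linear_comp[OF assms(2), of _ "\<lambda>u. \<beta> u (g y)"])
       (use assms(1) in \<open>simp add: bilinear_map_def\<close>)
  show "Vector_Spaces.linear sB sX (\<lambda>y. \<beta> (f x) (g y))" for x
    by (rule linear_comp[OF assms(3)]) (use assms(1) in \<open>simp add: bilinear_map_def\<close>)
qed

lemma bilinear_map_flip:
  "bilinear_map sV sW sX \<beta> \<Longrightarrow> bilinear_map sW sV sX (\<lambda>y x. \<beta> x y)"
  by (auto simp: bilinear_map_def)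

lemma bilinear_map_linear:
  assumes "bilinear_map sV sW sX \<beta>"
  shows "Vector_Spaces.linear sV sX (\<lambda>x. \<beta> x y)" "Vector_Spaces.linear sW sX (\<beta> x)"
  using assms by (auto simp: bilinear_map_def)

section \<open>Induced maps and their values on pure tensors\<close>

context tensor_powers
begin

lemmas linear_tL = bilinear_map_linear[OF L.bilinear_tens]
lemmas linear_tR = bilinear_map_linear[OF R.bilinear_tens]

lemma
  assumes "Vector_Spaces.linear s s f" "Vector_Spaces.linear s s g"
  shows linear_map11: "Vector_Spaces.linear s2 s2 (f \<otimes>\<^sub>1\<^sub>1 g)"
    and map11_tens: "(f \<otimes>\<^sub>1\<^sub>1 g) (t x y) = t (f x) (g y)"
  using C2.linear_lift C2.lift_tens C2.T.vector_space_axioms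
    bilinear_map_pre[OF C2.bilinear_tens assms] unfolding map11_def by blast+

lemma
  assumes "Vector_Spaces.linear s s2 f" "Vector_Spaces.linear s s g"
  shows linear_map21: "Vector_Spaces.linear s2 s3 (f \<otimes>\<^sub>2\<^sub>1 g)"
    and map21_tens: "(f \<otimes>\<^sub>2\<^sub>1 g) (t x y) = tL (f x) (g y)"
  using C2.linear_lift C2.lift_tens L.T.vector_space_axioms
    bilinear_map_pre[OF L.bilinear_tens assms] unfolding map21_def by blast+

lemma
  assumes "Vector_Spaces.linear s s f" "Vector_Spaces.linear s s2 g"
  shows linear_map12: "Vector_Spaces.linear s2 s3 (f \<otimes>\<^sub>1\<^sub>2 g)"
    and map12_tens: "(f \<otimes>\<^sub>1\<^sub>2 g) (t x y) = tR (f x) (g y)"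
  using C2.linear_lift C2.lift_tens L.T.vector_space_axioms
    bilinear_map_pre[OF R.bilinear_tens assms] unfolding map12_def by blast+

lemma
  shows linear_\<tau>: "Vector_Spaces.linear s2 s2 \<tau>"
    and \<tau>_tens: "\<tau> (t x y) = t y x"
  using C2.linear_lift C2.lift_tens C2.T.vector_space_axioms
    bilinear_map_flip[OF C2.bilinear_tens] unfolding \<tau>_def by blast+

lemma
  shows linear_\<tau>I: "Vector_Spaces.linear s3 s3 \<tau>I"
    and \<tau>I_tens: "\<tau>I (tL p z) = tL (\<tau> p) z"
  using L.linear_lift L.lift_tens L.T.vector_space_axioms
    bilinear_map_pre[OF L.bilinear_tens linear_\<tau> linear_ident[OF C2.V.vector_space_axioms]]
  unfolding \<tau>I_def by blast+

lemma
  shows linear_\<xi>: "Vector_Spaces.linear s3 s3 \<xi>"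
    and \<xi>_tens: "\<xi> (tR x p) = tL p x"
  using R.linear_lift R.lift_tens L.T.vector_space_axioms
    bilinear_map_flip[OF L.bilinear_tens] unfolding \<xi>_def by blast+

lemma \<xi>_tens3: "\<xi> (tR x (t y z)) = tR y (t z x)"
  by (simp add: \<xi>_tens assoc)

lemma \<tau>I_tens3: "\<tau>I (tR x (t y z)) = tR y (t x z)"
  by (simp add: \<tau>I_tens \<tau>_tens flip: assoc)

text \<open>Two uses of uniqueness: \<open>R\<close> reduces to arguments \<open>tR x p\<close>, and
  for fixed \<open>x\<close> both sides are linear in \<open>p\<close>, so \<open>C2\<close> reduces
  \<open>p\<close> to a pure tensor.\<close>

lemma linear_eqI3:
  assumes "Vector_Spaces.linear s3 sX \<phi>" "Vector_Spaces.linear s3 sX \<psi>"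
    and eq: "\<And>x y z. \<phi> (tR x (t y z)) = \<psi> (tR x (t y z))"
  shows "\<phi> = \<psi>"
proof (rule R.linear_eqI[OF assms(1,2)])
  fix x p
  have "(\<lambda>p. \<phi> (tR x p)) = (\<lambda>p. \<psi> (tR x p))"
    by (rule C2.linear_eqI[OF linear_comp[OF linear_tR(2) assms(1)]
          linear_comp[OF linear_tR(2) assms(2)]]) (rule eq)
  then show "\<phi> (tR x p) = \<psi> (tR x p)" by (rule fun_cong)
qed

section \<open>Action of the symmetric group\<close>

lemma \<tau>_\<tau>: "\<tau> (\<tau> v) = v"
  by (rule fun_cong[OF C2.linear_eqI[OF linear_comp[OF linear_\<tau> linear_\<tau>]
          linear_ident[OF C2.T.vector_space_axioms]]]) (simp add: \<tau>_tens)

lemma \<tau>I_\<tau>I: "\<tau>I (\<tau>I v) = v"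
  by (rule fun_cong[OF linear_eqI3[OF linear_comp[OF linear_\<tau>I linear_\<tau>I]
          linear_ident[OF L.T.vector_space_axioms]]]) (simp add: \<tau>I_tens3)

lemma \<xi>_\<xi>_\<xi>: "\<xi> (\<xi> (\<xi> v)) = v"
  by (rule fun_cong[OF linear_eqI3[OF linear_comp[OF linear_comp[OF linear_\<xi> linear_\<xi>] linear_\<xi>]
          linear_ident[OF L.T.vector_space_axioms]]]) (simp add: \<xi>_tens3)

text \<open>A transposition conjugates a 3-cycle to its inverse. As a rewrite rule this moves
  \<open>\<tau>I\<close> to the left of \<open>\<xi>\<close>.\<close>

lemma \<xi>_\<tau>I: "\<xi> (\<tau>I v) = \<tau>I (\<xi> (\<xi> v))"
  by (rule fun_cong[OF linear_eqI3[OF linear_comp[OF linear_\<tau>I linear_\<xi>]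
          linear_comp[OF linear_comp[OF linear_\<xi> linear_\<xi>] linear_\<tau>I]]])
     (simp add: \<tau>I_tens3 \<xi>_tens3)

text \<open>\<open>\<xi>\<close> moves the first leg to the end, so its inverse
  \<open>\<xi> \<circ> \<xi>\<close> moves the last leg to the front.\<close>

lemma \<xi>_\<xi>_tens: "\<xi> (\<xi> (tL p z)) = tR z p"
  by (rule fun_cong[OF C2.linear_eqI[OF
          linear_comp[OF linear_comp[OF linear_tL(1) linear_\<xi>] linear_\<xi>] linear_tR(2)]])
     (simp add: assoc \<xi>_tens3)

text \<open>\<open>\<tau>I \<circ> \<xi> \<circ> \<xi>\<close> is \<open>I \<otimes> \<tau>\<close>.\<close>

lemma tR_\<tau>: "tR x (\<tau> p) = \<tau>I (\<xi> (\<xi> (tR x p)))"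
  by (rule fun_cong[OF C2.linear_eqI[OF linear_comp[OF linear_\<tau> linear_tR(2)]
          linear_comp[OF linear_comp[OF linear_comp[OF linear_tR(2) linear_\<xi>] linear_\<xi>] linear_\<tau>I]]])
     (simp add: \<tau>_tens \<tau>I_tens3 \<xi>_tens3)

section \<open>Moving flips past tensor products of maps\<close>

lemma map11_\<tau>:
  assumes "Vector_Spaces.linear s s f" "Vector_Spaces.linear s s g"
  shows "(f \<otimes>\<^sub>1\<^sub>1 g) (\<tau> v) = \<tau> ((g \<otimes>\<^sub>1\<^sub>1 f) v)"
  by (rule fun_cong[OF C2.linear_eqI[OF linear_comp[OF linear_\<tau> linear_map11[OF assms]]
          linear_comp[OF linear_map11[OF assms(2,1)] linear_\<tau>]]])
     (simp add: \<tau>_tens map11_tens assms)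

context
  fixes f a
  assumes f: "Vector_Spaces.linear s s2 f" and a: "Vector_Spaces.linear s s a"
begin

lemma map21_\<tau>: "(f \<otimes>\<^sub>2\<^sub>1 a) (\<tau> v) = \<xi> ((a \<otimes>\<^sub>1\<^sub>2 f) v)"
  by (rule fun_cong[OF C2.linear_eqI[OF linear_comp[OF linear_\<tau> linear_map21[OF f a]]
          linear_comp[OF linear_map12[OF a f] linear_\<xi>]]])
     (simp add: \<tau>_tens map21_tens map12_tens f a \<xi>_tens)

text \<open>The flip carries the leg \<open>a y\<close> from behind the block \<open>f x\<close> to
  its front, which is the inverse of \<open>\<xi>\<close>.\<close>

lemma map12_\<tau>: "(a \<otimes>\<^sub>1\<^sub>2 f) (\<tau> v) = \<xi> (\<xi> ((f \<otimes>\<^sub>2\<^sub>1 a) v))"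
  by (rule fun_cong[OF C2.linear_eqI[OF linear_comp[OF linear_\<tau> linear_map12[OF a f]]
          linear_comp[OF linear_comp[OF linear_map21[OF f a] linear_\<xi>] linear_\<xi>]]])
     (simp add: \<tau>_tens map21_tens map12_tens f a \<xi>_\<xi>_tens)

lemma map21_\<tau>_comp: "((\<tau> \<circ> f) \<otimes>\<^sub>2\<^sub>1 a) v = \<tau>I ((f \<otimes>\<^sub>2\<^sub>1 a) v)"
  by (rule fun_cong[OF C2.linear_eqI[OF linear_map21[OF linear_comp_fun[OF linear_\<tau> f] a]
          linear_comp[OF linear_map21[OF f a] linear_\<tau>I]]])
     (simp add: map21_tens linear_comp_fun[OF linear_\<tau>] f a \<tau>I_tens)

lemma map12_\<tau>_comp: "(a \<otimes>\<^sub>1\<^sub>2 (\<tau> \<circ> f)) v = \<tau>I (\<xi> (\<xi> ((a \<otimes>\<^sub>1\<^sub>2 f) v)))"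
  by (rule fun_cong[OF C2.linear_eqI[OF linear_map12[OF a linear_comp_fun[OF linear_\<tau> f]]
          linear_comp[OF linear_comp[OF linear_comp[OF linear_map12[OF a f] linear_\<xi>] linear_\<xi>]
            linear_\<tau>I]]])
     (simp add: map12_tens linear_comp_fun[OF linear_\<tau>] f a tR_\<tau>)

lemma map21_diff:
  assumes g: "Vector_Spaces.linear s s2 g"
  shows "((f - g) \<otimes>\<^sub>2\<^sub>1 a) v = (f \<otimes>\<^sub>2\<^sub>1 a) v - (g \<otimes>\<^sub>2\<^sub>1 a) v"
proof -
  have "(f - g) \<otimes>\<^sub>2\<^sub>1 a = (f \<otimes>\<^sub>2\<^sub>1 a) - (g \<otimes>\<^sub>2\<^sub>1 a)"
    by (rule C2.linear_eqI[OF linear_map21[OF linear_diff_fun[OF f g] a]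
          linear_diff_fun[OF linear_map21[OF f a] linear_map21[OF g a]]])
       (simp add: map21_tens linear_diff_fun f g a linear_map_diff[OF linear_tL(1)])
  then show ?thesis by simp
qed

lemma map12_diff:
  assumes g: "Vector_Spaces.linear s s2 g"
  shows "(a \<otimes>\<^sub>1\<^sub>2 (f - g)) v = (a \<otimes>\<^sub>1\<^sub>2 f) v - (a \<otimes>\<^sub>1\<^sub>2 g) v"
proof -
  have "a \<otimes>\<^sub>1\<^sub>2 (f - g) = (a \<otimes>\<^sub>1\<^sub>2 f) - (a \<otimes>\<^sub>1\<^sub>2 g)"
    by (rule C2.linear_eqI[OF linear_map12[OF a linear_diff_fun[OF f g]]
          linear_diff_fun[OF linear_map12[OF a f] linear_map12[OF a g]]])
       (simp add: map12_tens linear_diff_fun f g a linear_map_diff[OF linear_tR(2)])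
  then show ?thesis by simp
qed

end

end

section \<open>The post-Hom-Lie axioms\<close>

context hom_tridendriform_coalgebra
begin

text \<open>Abbreviations keep the differences visible to \<open>map21_diff\<close> and
  \<open>map12_diff\<close>.\<close>

abbreviation (input) cobracket where "cobracket \<equiv> D0 - (\<tau> \<circ> D0)"
abbreviation (input) comult where "comult \<equiv> D1 - (\<tau> \<circ> Dm)"

text \<open>The composites with \<open>\<tau>\<close> discharge the linearity premises of
  \<open>map21_diff\<close> and \<open>map12_diff\<close>.\<close>

lemmas linear_components = linear_Dm linear_D0 linear_D1 linear_\<alpha>
  linear_comp_fun[OF linear_\<tau> linear_Dm] linear_comp_fun[OF linear_\<tau> linear_D0]

lemmas expand_linear =
  linear_map_diff[OF linear_\<tau>] linear_map_diff[OF linear_\<tau>I] linear_map_diff[OF linear_\<xi>]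
  linear_map_add[OF linear_\<tau>I] linear_map_add[OF linear_\<xi>]
  linear_map_diff[OF linear_map21[OF linear_Dm linear_\<alpha>]]
  linear_map_diff[OF linear_map21[OF linear_D0 linear_\<alpha>]]
  linear_map_diff[OF linear_map21[OF linear_D1 linear_\<alpha>]]
  linear_map_diff[OF linear_map12[OF linear_\<alpha> linear_Dm]]
  linear_map_diff[OF linear_map12[OF linear_\<alpha> linear_D0]]
  linear_map_diff[OF linear_map12[OF linear_\<alpha> linear_D1]]

text \<open>
  Rewriting with these rules brings every composite to a signed sum of terms \<open>\<tau>I\<^sup>i (\<xi>\<^sup>j w)\<close>, where
  \<open>w\<close> is one of the composites in the tridendriform axioms.
\<close>

lemmas expand =
  map21_diff map12_diff map21_\<tau>_comp map12_\<tau>_comp map21_\<tau> map12_\<tau>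
  \<tau>I_\<tau>I \<xi>_\<xi>_\<xi> \<xi>_\<tau>I \<tau>_\<tau> expand_linear linear_components

text \<open>Read left to right, no right side contains a left side, so one pass eliminates seven of
  the composites.\<close>

lemmas tridend_apply =
  tridend1[THEN fun_cong, unfolded comp_apply plus_fun_apply]
  tridend2[THEN fun_cong, unfolded comp_apply]
  tridend3[THEN fun_cong, unfolded comp_apply plus_fun_apply]
  tridend4[THEN fun_cong, unfolded comp_apply]
  tridend5[THEN fun_cong, unfolded comp_apply]
  tridend6[THEN fun_cong, unfolded comp_apply]
  tridend7[THEN fun_cong, unfolded comp_apply]

lemma post_hom_lie_coalgebra_nonmult:
  "post_hom_lie_coalgebra_nonmult s s2 s3 t tL tR cobracket comult \<alpha>"
proof (intro post_hom_lie_coalgebra_nonmult.intro post_hom_lie_coalgebra_nonmult_axioms.intro)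
  show "tensor_powers s s2 s3 t tL tR" by (rule tensor_powers_axioms)
  show "Vector_Spaces.linear s s2 cobracket" "Vector_Spaces.linear s s2 comult"
    by (intro linear_diff_fun linear_components)+
  show "Vector_Spaces.linear s s \<alpha>" by (rule linear_\<alpha>)
  show "cobracket = - (\<tau> \<circ> cobracket)"
    by (rule ext) (simp add: expand)
  \<comment> \<open>By \<open>tridend7\<close> only one composite \<open>w\<close> occurs: the inner
    value is \<open>w - \<xi> (\<xi> w)\<close> plus
    \<open>\<tau>I (\<xi> w - \<xi> (\<xi> w))\<close>, and the cyclic sum kills both parts.\<close>
  show "(id + \<xi> + (\<xi> \<circ> \<xi>)) \<circ> (\<alpha> \<otimes>\<^sub>1\<^sub>2 cobracket) \<circ> cobracket = 0"
    by (rule ext) (simp add: expand tridend_apply)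
  \<comment> \<open>The composites involved are those of \<open>tridend4\<close>,
    \<open>tridend5\<close> and \<open>tridend6\<close>.\<close>
  show "((\<alpha> \<otimes>\<^sub>1\<^sub>2 cobracket) \<circ> comult) - ((comult \<otimes>\<^sub>2\<^sub>1 \<alpha>) \<circ> cobracket)
      - (\<tau>I \<circ> (\<alpha> \<otimes>\<^sub>1\<^sub>2 comult) \<circ> cobracket) = 0"
    by (rule ext) (simp add: expand tridend_apply)
  \<comment> \<open>The first four terms are \<open>id - \<tau>I\<close> applied to a difference. By
    \<open>tridend1\<close>, \<open>tridend2\<close> and \<open>tridend3\<close> that difference is
    \<open>\<tau>I\<close>-invariant up to terms with \<open>D0\<close>, which the last summand
    cancels.\<close>
  show "((comult \<otimes>\<^sub>2\<^sub>1 \<alpha>) \<circ> comult) - ((\<alpha> \<otimes>\<^sub>1\<^sub>2 comult) \<circ> comult)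
      - (\<tau>I \<circ> (comult \<otimes>\<^sub>2\<^sub>1 \<alpha>) \<circ> comult) + (\<tau>I \<circ> (\<alpha> \<otimes>\<^sub>1\<^sub>2 comult) \<circ> comult)
      + ((cobracket \<otimes>\<^sub>2\<^sub>1 \<alpha>) \<circ> comult) = 0"
    by (rule ext) (simp add: expand tridend_apply)
qed

text \<open>By \<open>map11_\<tau>\<close> the flip commutes with
  \<open>\<alpha> \<otimes>\<^sub>1\<^sub>1 \<alpha>\<close>, so the property passes from
  \<open>D0\<close> to its antisymmetrization.\<close>

lemma cobracket_comultiplicative:
  assumes "D0 \<circ> \<alpha> = (\<alpha> \<otimes>\<^sub>1\<^sub>1 \<alpha>) \<circ> D0"
  shows "cobracket \<circ> \<alpha> = (\<alpha> \<otimes>\<^sub>1\<^sub>1 \<alpha>) \<circ> cobracket"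
  by (rule ext) (simp add: linear_map_diff[OF linear_map11] linear_\<alpha> map11_\<tau>
      assms[THEN fun_cong, unfolded comp_apply])

end

theorem proposition4p17:
  fixes s :: "'f::field_char_0 \<Rightarrow> 'c::ab_group_add \<Rightarrow> 'c"
    and s2 :: "'f \<Rightarrow> 'c2::ab_group_add \<Rightarrow> 'c2"
    and s3 :: "'f \<Rightarrow> 'c3::ab_group_add \<Rightarrow> 'c3"
    and t :: "'c \<Rightarrow> 'c \<Rightarrow> 'c2" and tL :: "'c2 \<Rightarrow> 'c \<Rightarrow> 'c3" and tR :: "'c \<Rightarrow> 'c2 \<Rightarrow> 'c3"
    and Dm D0 D1 :: "'c \<Rightarrow> 'c2" and \<alpha> :: "'c \<Rightarrow> 'c"
  assumes "hom_tridendriform_coalgebra s s2 s3 t tL tR Dm D0 D1 \<alpha>"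
  defines "\<tau> \<equiv> tensor_powers.\<tau> s2 t"
  defines "\<gamma> \<equiv> (id - \<tau>) \<circ> D0"
    and "D \<equiv> D1 - (\<tau> \<circ> Dm)"
  shows "post_hom_lie_coalgebra_nonmult s s2 s3 t tL tR \<gamma> D \<alpha> \<and>
    (D0 \<circ> \<alpha> = tensor_powers.map11 s2 t \<alpha> \<alpha> \<circ> D0 \<longrightarrow>
      post_hom_lie_coalgebra s s2 s3 t tL tR \<gamma> D \<alpha>)"
proof -
  \<comment> \<open>Renamed before the interpretation brings in the locale's own
    \<open>\<tau>_def\<close>.\<close>
  note \<tau> = \<tau>_def
  interpret hom_tridendriform_coalgebra s s2 s3 t tL tR Dm D0 D1 \<alpha> by fact
  have \<gamma>: "\<gamma> = D0 - (tensor_powers.\<tau> s2 t \<circ> D0)"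
    unfolding \<gamma>_def \<tau> by (rule ext) simp
  note nonmult = post_hom_lie_coalgebra_nonmult[folded \<gamma>, folded \<tau>, folded D_def]
  show ?thesis
    using nonmult cobracket_comultiplicative[folded \<gamma>]
    by (simp add: post_hom_lie_coalgebra_def post_hom_lie_coalgebra_axioms_def)
qed

end
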